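(* Let $f\in\mathcal F_{m,L}$ with minimizer $x^\star$, let $\bar A\in\mathbb R^{n\times n}$, $\bar B\in\mathbb R^{n\times d}$, $\bar C\in\mathbb R^{d\times n}$ ($d\le n$), and consider the system $$\dot\xi(t)=\bar A\xi(t)+\bar B u(t),\qquad x(t)=\bar C\xi(t),\qquad u(t)=\nabla f(x(t)),\qquad t\ge 0,$$ with fixed point $\xi^\star\in\mathbb R^n$ satisfying $\bar A\xi^\star=0$, $\bar C\xi^\star=x^\star$. Suppose that there exist $\lambda>0$, $\sigma\ge 0$ and a symmetric matrix $\bar P\in\mathbb R^{n\times n}$ with $\widetilde P:=\bar P+\frac m2\bar C^{T}\bar C\succ 0$ that satisfy $$\bar T=\bar M^{(0)}+\bar M^{(1)}+\lambda\bar M^{(2)}+\sigma\bar M^{(3)}\preceq 0,$$ where $$\bar M^{(0)}=\begin{bmatrix}\bar P\bar A+\bar A^{T}\bar P+\lambda\bar P & \bar P\bar B\\ \bar B^{T}\bar P & 0\end{bmatrix},\qquad \bar M^{(1)}=\frac12\begin{bmatrix}0&(\bar C\bar A)^{T}\\ \bar C\bar A&\bar C\bar B+\bar B^{T}\bar C^{T}\end{bmatrix},$$ $$\bar M^{(2)}=\begin{bmatrix}\bar C^{T}&0\\0&I_d\end{bmatrix}\begin{bmatrix}-\frac m2 I_d&\frac12 I_d\\ \frac12 I_d&0\end{bmatrix}\begin{bmatrix}\bar C&0\\0&I_d\end{bmatrix},$$ $$\bar M^{(3)}=\begin{bmatrix}\bar C^{T}&0\\0&I_d\end{bmatrix}\begin{bmatrix}-\frac{mL}{m+L}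 I_d&\frac12 I_d\\ \frac12 I_d&-\frac1{m+L}I_d\end{bmatrix}\begin{bmatrix}\bar C&0\\0&I_d\end{bmatrix}.$$ Then, for every solution of the system and every $t\ge 0$, $$\|x(t)-x^\star\|^2\le \lambda_{\max}(\bar C^{T}\bar C)\,\|\xi(t)-\xi^\star\|^2\le\frac{\lambda_{\max}(\bar C^{T}\bar C)}{\lambda_{\min}(\widetilde P)}\,\|\xi(t)-\xi^\star\|_{\widetilde P}^2\le\frac{\lambda_{\max}(\bar C^{T}\bar C)}{\lambda_{\min}(\widetilde P)}\,e^{-\lambda t}\,V(\xi(0),0),$$ where $$V(\xi(t),t)=e^{\lambda t}\Big(f(x(t))-f(x^\star)+(\xi(t)-\xi^\star)^{T}\bar P(\xi(t)-\xi^\star)\Big).$$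
   Context: For $0<m\le L$, $\mathcal F_{m,L}$ denotes the set of differentiable functions $f:\mathbb R^d\to\mathbb R$ that are $m$-strongly convex and have $L$-Lipschitz gradient. $I_d$ is the $d\times d$ identity. $\|\cdot\|$ is the Euclidean norm, and $\|w\|_{\widetilde P}^2:=w^{T}\widetilde P w$. $\lambda_{\max}(\cdot)$, $\lambda_{\min}(\cdot)$ denote the largest and smallest eigenvalue of a symmetric matrix. $X\succ0$ (resp. $X\preceq 0$) means that the symmetric matrix $X$ is positive definite (resp. negative semidefinite). $\bar P$ is not required to be positive semidefinite. *)

theory Defs
  imports "HOL-Analysis.Analysis"
begin

subsection \<open>The function class\<close>

text \<open>\<open>gradient f x\<close> is meaningful only where \<open>f\<close> is differentiable.\<close>

definition gradient :: "(real ^ 'd \<Rightarrow> real) \<Rightarrow> real ^ 'd \<Rightarrow> real ^ 'd"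
  where "gradient f x = (THE g. GDERIV f x :> g)"

lemma GDERIV_gradient:
  fixes f :: "real ^ 'd \<Rightarrow> real"
  assumes "f differentiable (at x)"
  shows "GDERIV f x :> gradient f x"
proof -
  obtain f' where f': "(f has_derivative f') (at x)"
    using assms by (auto simp: differentiable_def)
  then interpret bounded_linear f'
    by (rule has_derivative_bounded_linear)
  have "f' = (\<lambda>h. h \<bullet> adjoint f' 1)"
    using adjoint_works[OF linear_axioms, of _ 1] by (auto simp: fun_eq_iff)
  with f' have ex: "GDERIV f x :> adjoint f' 1"
    by (simp add: gderiv_def)
  moreover have "g = adjoint f' 1" if "GDERIV f x :> g" for g
    using has_derivative_unique[OF that[unfolded gderiv_def] ex[unfolded gderiv_def]]
    by (metis vector_eq_ldot)
  ultimately show ?thesis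
    unfolding gradient_def by (rule theI)
qed

definition strongly_convex_on :: "(real ^ 'd) set \<Rightarrow> real \<Rightarrow> (real ^ 'd \<Rightarrow> real) \<Rightarrow> bool"
  where "strongly_convex_on S m f \<longleftrightarrow> convex S \<and>
    (\<forall>x\<in>S. \<forall>y\<in>S. \<forall>u\<ge>0. \<forall>v\<ge>0. u + v = 1 \<longrightarrow>
      f (u *\<^sub>R x + v *\<^sub>R y) \<le> u * f x + v * f y - m / 2 * u * v * (norm (x - y))\<^sup>2)"

definition smooth_strongly_convex :: "real \<Rightarrow> real \<Rightarrow> (real ^ 'd \<Rightarrow> real) set"
  where "smooth_strongly_convex m L =
    {f. (\<forall>x. f differentiable (at x)) \<and> strongly_convex_on UNIV m f \<and>
        lipschitz_on L UNIV (gradient f)}"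

subsection \<open>Matrices\<close>

definition eigenvalues :: "real ^ 'n ^ 'n \<Rightarrow> real set"
  where "eigenvalues X = {k. \<exists>v. v \<noteq> 0 \<and> X *v v = k *\<^sub>R v}"

text \<open>Only used for symmetric matrices, whose set of real eigenvalues is finite and nonempty.\<close>

definition lambda_max :: "real ^ 'n ^ 'n \<Rightarrow> real"
  where "lambda_max X = Max (eigenvalues X)"

definition lambda_min :: "real ^ 'n ^ 'n \<Rightarrow> real"
  where "lambda_min X = Min (eigenvalues X)"

definition symmetric_matrix :: "real ^ 'n ^ 'n \<Rightarrow> bool"
  where "symmetric_matrix X \<longleftrightarrow> transpose X = X"

definition quad_form :: "real ^ 'n ^ 'n \<Rightarrow> real ^ 'n \<Rightarrow> real"
  where "quad_form X w = w \<bullet> (X *v w)"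

definition pos_definite :: "real ^ 'n ^ 'n \<Rightarrow> bool"
  where "pos_definite X \<longleftrightarrow> symmetric_matrix X \<and> (\<forall>w. w \<noteq> 0 \<longrightarrow> 0 < quad_form X w)"

definition neg_semidefinite :: "real ^ 'n ^ 'n \<Rightarrow> bool"
  where "neg_semidefinite X \<longleftrightarrow> symmetric_matrix X \<and> (\<forall>w. quad_form X w \<le> 0)"

text \<open>\<open>block_mat P Q R S\<close> has rows \<open>[P Q]\<close> and \<open>[R S]\<close>; the index type of a stacked
  dimension is the sum type, and \<open>real ^ 'c ^ 'r\<close> has \<open>'r\<close> as its row index.\<close>

definition block_mat ::
  "real ^ 'c1 ^ 'r1 \<Rightarrow> real ^ 'c2 ^ 'r1 \<Rightarrow> real ^ 'c1 ^ 'r2 \<Rightarrow> real ^ 'c2 ^ 'r2 \<Rightarrow>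
    real ^ ('c1 + 'c2) ^ ('r1 + 'r2)"
  where "block_mat P Q R S = (\<chi> i j.
    case i of
      Inl i1 \<Rightarrow> (case j of Inl j1 \<Rightarrow> P $ i1 $ j1 | Inr j2 \<Rightarrow> Q $ i1 $ j2)
    | Inr i2 \<Rightarrow> (case j of Inl j1 \<Rightarrow> R $ i2 $ j1 | Inr j2 \<Rightarrow> S $ i2 $ j2))"

subsection \<open>The linear matrix inequality\<close>

definition P_tilde :: "real \<Rightarrow> real ^ 'n ^ 'd \<Rightarrow> real ^ 'n ^ 'n \<Rightarrow> real ^ 'n ^ 'n"
  where "P_tilde m C P = P + (m / 2) *\<^sub>R (transpose C ** C)"

definition M0 ::
  "real \<Rightarrow> real ^ 'n ^ 'n \<Rightarrow> real ^ 'd ^ 'n \<Rightarrow> real ^ 'n ^ 'n \<Rightarrow> real ^ ('n + 'd) ^ ('n + 'd)"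
  where "M0 lam A B P =
    block_mat (P ** A + transpose A ** P + lam *\<^sub>R P) (P ** B)
              (transpose B ** P)                     0"

definition M1 ::
  "real ^ 'n ^ 'n \<Rightarrow> real ^ 'd ^ 'n \<Rightarrow> real ^ 'n ^ 'd \<Rightarrow> real ^ ('n + 'd) ^ ('n + 'd)"
  where "M1 A B C =
    (1 / 2) *\<^sub>R block_mat 0        (transpose (C ** A))
                        (C ** A) (C ** B + transpose B ** transpose C)"

definition M2 :: "real \<Rightarrow> real ^ 'n ^ 'd \<Rightarrow> real ^ ('n + 'd) ^ ('n + 'd)"
  where "M2 m C =
    block_mat (transpose C) 0 0 (mat 1)
    ** block_mat ((- (m / 2)) *\<^sub>R mat 1) ((1 / 2) *\<^sub>R mat 1)
                 ((1 / 2) *\<^sub>R mat 1)     (0 :: real ^ 'd ^ 'd)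
    ** block_mat C 0 0 (mat 1)"

definition M3 :: "real \<Rightarrow> real \<Rightarrow> real ^ 'n ^ 'd \<Rightarrow> real ^ ('n + 'd) ^ ('n + 'd)"
  where "M3 m L C =
    block_mat (transpose C) 0 0 (mat 1)
    ** block_mat ((- (m * L / (m + L))) *\<^sub>R mat 1) ((1 / 2) *\<^sub>R mat 1)
                 ((1 / 2) *\<^sub>R mat 1) ((- (1 / (m + L))) *\<^sub>R (mat 1 :: real ^ 'd ^ 'd))
    ** block_mat C 0 0 (mat 1)"

definition T_bar ::
  "real \<Rightarrow> real \<Rightarrow> real \<Rightarrow> real \<Rightarrow> real ^ 'n ^ 'n \<Rightarrow> real ^ 'd ^ 'n \<Rightarrow> real ^ 'n ^ 'd \<Rightarrow>
    real ^ 'n ^ 'n \<Rightarrow> real ^ ('n + 'd) ^ ('n + 'd)"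
  where "T_bar m L lam sig A B C P =
    M0 lam A B P + M1 A B C + lam *\<^sub>R M2 m C + sig *\<^sub>R M3 m L C"

subsection \<open>The system and the Lyapunov function\<close>

text \<open>At time \<open>0\<close> the derivative is the one-sided one.\<close>

definition is_solution ::
  "real ^ 'n ^ 'n \<Rightarrow> real ^ 'd ^ 'n \<Rightarrow> real ^ 'n ^ 'd \<Rightarrow> (real ^ 'd \<Rightarrow> real) \<Rightarrow>
    (real \<Rightarrow> real ^ 'n) \<Rightarrow> (real \<Rightarrow> real ^ 'd) \<Rightarrow> (real \<Rightarrow> real ^ 'd) \<Rightarrow> bool"
  where "is_solution A B C f \<xi> x u \<longleftrightarrow>
    (\<forall>t\<ge>0. (\<xi> has_vector_derivative (A *v \<xi> t + B *v u t)) (at t within {0..}) \<and>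
           x t = C *v \<xi> t \<and> u t = gradient f (x t))"

definition lyapunov ::
  "real \<Rightarrow> (real ^ 'd \<Rightarrow> real) \<Rightarrow> real ^ 'n ^ 'd \<Rightarrow> real ^ 'n ^ 'n \<Rightarrow> real ^ 'd \<Rightarrow> real ^ 'n \<Rightarrow>
    real ^ 'n \<Rightarrow> real \<Rightarrow> real"
  where "lyapunov lam f C P xstar \<xi>star w t =
    exp (lam * t) * (f (C *v w) - f xstar + (w - \<xi>star) \<bullet> (P *v (w - \<xi>star)))"

end

theory Submission
  imports Defs
begin

text \<open>
  Write \<open>e = \<xi> - \<xi>\<^sup>\<star>\<close>, \<open>y = C e = x - x\<^sup>\<star>\<close> and \<open>u = \<nabla>f(x)\<close>. Since \<open>A \<xi>\<^sup>\<star> = 0\<close>, the error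
  obeys \<open>e' = A e + B u\<close>, so along a solution \<open>exp(-\<lambda>t) dV/dt\<close> is a quadratic form in the
  stacked vector \<open>z = (e, u)\<close>, up to the term \<open>\<lambda> (f(x) - f(x\<^sup>\<star>))\<close>: \<open>M0\<close> comes from
  differentiating \<open>exp(\<lambda>t) e\<^sup>T P e\<close> and \<open>M1\<close> from differentiating \<open>f(x)\<close>. The other two matrices
  encode what is known about \<open>f\<close>:

  \<^item> strong convexity between \<open>x\<close> and \<open>x\<^sup>\<star>\<close> says \<open>f(x) - f(x\<^sup>\<star>) \<le> u\<^sup>T y - m/2 |y|\<^sup>2\<close>, and
    the right-hand side is \<open>z\<^sup>T M2 z\<close> (\<open>strongly_convex_gradient_lower_bound\<close>);
  \<^item> cocoercivity of the gradient, together with \<open>\<nabla>f(x\<^sup>\<star>) = 0\<close>, says \<open>0 \<le> z\<^sup>T M3 z\<close>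
    (\<open>smooth_strongly_convex_cocoercive\<close>).

  Hence \<open>exp(-\<lambda>t) dV/dt \<le> z\<^sup>T T z \<le> 0\<close> (\<open>LMI_dissipation\<close>) and \<open>V\<close> does not increase. Although
  \<open>P\<close> may be indefinite, \<open>V\<close> controls the state: strong convexity at the minimizer gives
  \<open>f(x) - f(x\<^sup>\<star>) \<ge> m/2 |C e|\<^sup>2\<close>, which is exactly the term that completes \<open>P\<close> to the
  positive definite matrix of \<open>P_tilde\<close>. The first two inequalities of the chain are Rayleigh
  quotient bounds for \<open>C\<^sup>T C\<close> and \<open>P_tilde\<close>.
\<close>

section \<open>Extreme eigenvalues of symmetric matrices\<close>

lemma inner_matrix_vector_transpose:
  fixes M :: "real ^ 'n ^ 'k"
  shows "v \<bullet> (M *v w) = (transpose M *v v) \<bullet> w"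
  by (simp add: dot_matrix_vector_mul dot_lmul_matrix)

lemma symmetric_matrix_inner_commute:
  assumes "symmetric_matrix X"
  shows "v \<bullet> (X *v w) = w \<bullet> (X *v v)"
  using assms inner_matrix_vector_transpose[of v X w]
  by (simp add: symmetric_matrix_def inner_commute)

text \<open>
  Eigenvectors for different eigenvalues are orthogonal, hence independent. Finiteness is what
  makes \<open>Max\<close> and \<open>Min\<close> in \<open>lambda_max\<close> and \<open>lambda_min\<close> meaningful.
\<close>

lemma finite_eigenvalues_symmetric:
  fixes X :: "real ^ 'n ^ 'n"
  assumes sym: "symmetric_matrix X"
  shows "finite (eigenvalues X)"
proof -
  obtain ev where ev: "\<And>k. k \<in> eigenvalues X \<Longrightarrow> ev k \<noteq> 0 \<and> X *v ev k = k *\<^sub>R ev k"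
    using bchoice[of "eigenvalues X" "\<lambda>k v. v \<noteq> 0 \<and> X *v v = k *\<^sub>R v"]
    unfolding eigenvalues_def by blast
  have orth: "ev k \<bullet> ev l = 0"
    if "k \<in> eigenvalues X" "l \<in> eigenvalues X" "k \<noteq> l" for k l
  proof -
    have "l * (ev k \<bullet> ev l) = k * (ev k \<bullet> ev l)"
      using symmetric_matrix_inner_commute[OF sym, of "ev k" "ev l"] ev[OF that(1)] ev[OF that(2)]
      by (simp add: inner_commute)
    then show ?thesis
      using that(3) by simp
  qed
  have inj: "inj_on ev (eigenvalues X)"
  proof (rule inj_onI, rule ccontr)
    fix k l
    assume kl: "k \<in> eigenvalues X" "l \<in> eigenvalues X" "ev k = ev l" "k \<noteq> l"
    then have "ev k \<bullet> ev k = 0"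
      using orth[of k l] by simp
    then show False
      using ev[OF kl(1)] by simp
  qed
  have "pairwise orthogonal (ev ` eigenvalues X)"
    using orth by (auto simp: pairwise_def orthogonal_def)
  moreover have "0 \<notin> ev ` eigenvalues X"
    using ev by auto
  ultimately have "independent (ev ` eigenvalues X)"
    by (rule pairwise_orthogonal_independent)
  then have "finite (ev ` eigenvalues X)"
    by (rule independent_imp_finite)
  then show ?thesis
    using inj by (rule finite_imageD)
qed

lemma quad_form_scaleR: "quad_form X (c *\<^sub>R w) = c\<^sup>2 * quad_form X w"
  by (simp add: quad_form_def matrix_vector_mult_scaleR power2_eq_square)

text \<open>
  The Rayleigh quotient attains its maximum \<open>k\<close> at some unit vector \<open>v\<close>. The form of \<open>k I - X\<close> is
  nonnegative and vanishes at \<open>v\<close>; moving from \<open>v\<close> a little against the residual \<open>r = k v - X v\<close>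
  changes it by \<open>-2 s |r|\<^sup>2\<close> to first order in the step \<open>s\<close>, so \<open>r\<close> must vanish.
\<close>

lemma symmetric_max_eigenvalue:
  fixes X :: "real ^ 'n ^ 'n"
  assumes sym: "symmetric_matrix X"
  shows "\<exists>k\<in>eigenvalues X. \<forall>w. quad_form X w \<le> k * (norm w)\<^sup>2"
proof -
  have "\<exists>v\<in>sphere 0 1. \<forall>w\<in>sphere 0 1. quad_form X w \<le> quad_form X v"
  proof (rule continuous_attains_sup)
    show "sphere (0 :: real ^ 'n) 1 \<noteq> {}" by simp
    show "continuous_on (sphere 0 1) (quad_form X)"
      unfolding quad_form_def
      by (intro continuous_intros linear_continuous_on matrix_vector_mul_bounded_linear)
  qed simp
  then obtain v where v: "norm v = 1"
    and vmax: "\<And>w. norm w = 1 \<Longrightarrow> quad_form X w \<le> quad_form X v"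
    by auto
  define k where "k = quad_form X v"
  have bound: "quad_form X w \<le> k * (norm w)\<^sup>2" for w
  proof (cases "w = 0")
    case False
    have "quad_form X w = (norm w)\<^sup>2 * quad_form X ((1 / norm w) *\<^sub>R w)"
      using False by (simp add: quad_form_scaleR power_divide)
    also have "\<dots> \<le> (norm w)\<^sup>2 * k"
      unfolding k_def using False by (intro mult_left_mono vmax) auto
    finally show ?thesis by (simp add: mult.commute)
  qed (simp add: quad_form_def)
  define r where "r = k *\<^sub>R v - X *v v"
  define c where "c = k * (norm r)\<^sup>2 - quad_form X r"
  have expand: "0 \<le> s\<^sup>2 * c - 2 * s * (norm r)\<^sup>2" for s
  proof -
    have q: "quad_form X (v - s *\<^sub>R r)
        = k - 2 * s * (r \<bullet> (X *v v)) + s\<^sup>2 * quad_form X r"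
      using symmetric_matrix_inner_commute[OF sym, of v r]
      by (simp add: k_def quad_form_def matrix_vector_mult_diff_distrib
          matrix_vector_mult_scaleR inner_diff_left inner_diff_right power2_eq_square algebra_simps)
    have n: "(norm (v - s *\<^sub>R r))\<^sup>2 = 1 - 2 * s * (r \<bullet> v) + s\<^sup>2 * (norm r)\<^sup>2"
      using v unfolding power2_norm_eq_inner norm_eq_1
      by (simp add: inner_diff_left inner_diff_right power2_eq_square algebra_simps inner_commute)
    have r: "(norm r)\<^sup>2 = k * (r \<bullet> v) - r \<bullet> (X *v v)"
      unfolding power2_norm_eq_inner by (subst (2) r_def) (simp add: inner_diff_right)
    have "0 \<le> k * (norm (v - s *\<^sub>R r))\<^sup>2 - quad_form X (v - s *\<^sub>R r)"
      using bound by simp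
    also have "\<dots> = s\<^sup>2 * c - 2 * s * (k * (r \<bullet> v) - r \<bullet> (X *v v))"
      unfolding q n c_def by (simp add: algebra_simps)
    finally show ?thesis
      by (simp only: r)
  qed
  have "norm r = 0"
  proof (rule ccontr)
    assume "norm r \<noteq> 0"
    then have pos: "0 < (norm r)\<^sup>2" by simp
    have "0 \<le> c"
      unfolding c_def using bound[of r] by simp
    \<comment> \<open>Any positive step with \<open>s * c < 2 * (norm r)\<^sup>2\<close> works; adding \<open>1\<close> covers \<open>c = 0\<close>.\<close>
    define s where "s = (norm r)\<^sup>2 / (c + 1)"
    have s: "0 < s" "s * c \<le> (norm r)\<^sup>2"
      using pos \<open>0 \<le> c\<close>
      by (auto simp: s_def pos_divide_le_eq intro!: mult_left_mono)
    have "s\<^sup>2 * c - 2 * s * (norm r)\<^sup>2 = s * (s * c - 2 * (norm r)\<^sup>2)"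
      by (simp add: power2_eq_square algebra_simps)
    also have "\<dots> < 0"
      using s pos by (intro mult_pos_neg) linarith+
    finally show False
      using expand[of s] by simp
  qed
  then have "X *v v = k *\<^sub>R v"
    by (simp add: r_def)
  then have "k \<in> eigenvalues X"
    using v unfolding eigenvalues_def by (intro CollectI exI[of _ v]) auto
  then show ?thesis
    using bound by blast
qed

lemma quad_form_le_lambda_max:
  assumes "symmetric_matrix X"
  shows "quad_form X w \<le> lambda_max X * (norm w)\<^sup>2"
proof -
  obtain k where "k \<in> eigenvalues X" and k: "quad_form X w \<le> k * (norm w)\<^sup>2"
    using symmetric_max_eigenvalue[OF assms] by blast
  then have "k \<le> lambda_max X"
    using finite_eigenvalues_symmetric[OF assms] by (simp add: lambda_max_def)
  then show ?thesis
    using k by (meson order_trans mult_right_mono zero_le_power2)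
qed

lemma matrix_vector_mult_uminus: "(- X) *v w = - (X *v (w :: real ^ 'n))"
  by (simp add: vec_eq_iff matrix_vector_mult_def sum_negf)

lemma lambda_min_le_quad_form:
  assumes "symmetric_matrix X"
  shows "lambda_min X * (norm w)\<^sup>2 \<le> quad_form X w"
proof -
  \<comment> \<open>The largest eigenvalue of \<open>- X\<close> is the negated smallest one of \<open>X\<close>.\<close>
  have "symmetric_matrix (- X)"
    using assms by (simp add: symmetric_matrix_def transpose_def vec_eq_iff)
  then obtain k where "k \<in> eigenvalues (- X)" and k: "quad_form (- X) w \<le> k * (norm w)\<^sup>2"
    using symmetric_max_eigenvalue by blast
  then obtain v where "v \<noteq> 0" and v: "- (X *v v) = k *\<^sub>R v"
    by (auto simp: eigenvalues_def matrix_vector_mult_uminus)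
  have "X *v v = (- k) *\<^sub>R v"
    by (simp flip: v)
  with \<open>v \<noteq> 0\<close> have "- k \<in> eigenvalues X"
    unfolding eigenvalues_def by blast
  then have "lambda_min X \<le> - k"
    using finite_eigenvalues_symmetric[OF assms] by (simp add: lambda_min_def)
  then have "lambda_min X * (norm w)\<^sup>2 \<le> - k * (norm w)\<^sup>2"
    by (rule mult_right_mono) simp
  also have "\<dots> \<le> quad_form X w"
    using k by (simp add: quad_form_def matrix_vector_mult_uminus)
  finally show ?thesis .
qed

lemma lambda_min_pos:
  assumes "pos_definite X"
  shows "0 < lambda_min X"
proof -
  have sym: "symmetric_matrix X"
    using assms by (simp add: pos_definite_def)
  have "lambda_min X \<in> eigenvalues X"
    unfolding lambda_min_def
    using symmetric_max_eigenvalue[OF sym] finite_eigenvalues_symmetric[OF sym]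
    by (intro Min_in) auto
  then obtain v where "v \<noteq> 0" and v: "X *v v = lambda_min X *\<^sub>R v"
    by (auto simp: eigenvalues_def)
  have "0 < v \<bullet> (X *v v)"
    using assms \<open>v \<noteq> 0\<close> by (simp add: pos_definite_def quad_form_def)
  then have "0 < lambda_min X * (v \<bullet> v)"
    by (simp add: v)
  then show ?thesis
    by (rule zero_less_mult_pos2) (simp add: \<open>v \<noteq> 0\<close>)
qed

lemma quad_form_gram: "quad_form (transpose C ** C) w = (norm (C *v w))\<^sup>2"
  using inner_matrix_vector_transpose[of "C *v w" C w]
  by (simp add: quad_form_def power2_norm_eq_inner inner_commute
      flip: matrix_vector_mul_assoc)

lemma symmetric_matrix_gram: "symmetric_matrix (transpose C ** C :: real ^ 'n ^ 'n)"
  by (simp add: symmetric_matrix_def matrix_transpose_mul)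

lemma lambda_max_gram_nonneg: "0 \<le> lambda_max (transpose C ** C :: real ^ 'n ^ 'n)"
proof -
  obtain w :: "real ^ 'n" where w: "norm w = 1"
    using vector_choose_size[of 1] by auto
  have "0 \<le> quad_form (transpose C ** C) w"
    by (simp add: quad_form_gram)
  also have "\<dots> \<le> lambda_max (transpose C ** C)"
    using quad_form_le_lambda_max[OF symmetric_matrix_gram, of C w] w by simp
  finally show ?thesis .
qed

section \<open>Inequalities for smooth strongly convex functions\<close>

lemma GDERIV_along_line:
  fixes f :: "real ^ 'd \<Rightarrow> real"
  assumes "f differentiable (at (a + s *\<^sub>R d))"
  shows "((\<lambda>s. f (a + s *\<^sub>R d)) has_real_derivative (gradient f (a + s *\<^sub>R d) \<bullet> d)) (at s)"
proof -
  have "((\<lambda>s. a + s *\<^sub>R d) has_derivative (\<lambda>h. h *\<^sub>R d)) (at s)"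
    by (auto intro!: derivative_eq_intros)
  then have "((\<lambda>s. f (a + s *\<^sub>R d)) has_derivative (\<lambda>h. (h *\<^sub>R d) \<bullet> gradient f (a + s *\<^sub>R d))) (at s)"
    by (rule has_derivative_compose) (use GDERIV_gradient[OF assms] in \<open>simp add: gderiv_def\<close>)
  then show ?thesis
    by (rule has_derivative_imp_has_field_derivative) (simp add: inner_commute)
qed

text \<open>
  Divide the strong convexity inequality along the segment from \<open>a\<close> to \<open>b\<close> by the parameter \<open>v\<close>
  and let \<open>v\<close> tend to \<open>0\<close> from the right: the difference quotient becomes the directional
  derivative, and the factor \<open>1 - v\<close> of the quadratic term disappears.
\<close>

lemma strongly_convex_gradient_lower_bound:
  fixes f :: "real ^ 'd \<Rightarrow> real"
  assumes sc: "strongly_convex_on UNIV m f" and diff: "f differentiable (at a)"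
  shows "f a + gradient f a \<bullet> (b - a) + m / 2 * (norm (b - a))\<^sup>2 \<le> f b"
proof -
  define q where "q = (norm (b - a))\<^sup>2"
  have "((\<lambda>v. f (a + v *\<^sub>R (b - a))) has_real_derivative (gradient f a \<bullet> (b - a))) (at 0)"
    using GDERIV_along_line[of f a 0 "b - a"] diff by simp
  then have lim: "((\<lambda>v. (f (a + v *\<^sub>R (b - a)) - f a) / v) \<longlongrightarrow> gradient f a \<bullet> (b - a)) (at_right 0)"
    unfolding DERIV_def by (auto intro: tendsto_within_subset)
  have le: "(f (a + v *\<^sub>R (b - a)) - f a) / v \<le> f b - f a - m / 2 * (1 - v) * q"
    if "0 < v" "v < 1" for v :: real
  proof -
    have "f ((1 - v) *\<^sub>R a + v *\<^sub>R b) \<le> (1 - v) * f a + v * f b - m / 2 * (1 - v) * v * (norm (a - b))\<^sup>2"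
      using sc that unfolding strongly_convex_on_def by auto
    moreover have "(1 - v) *\<^sub>R a + v *\<^sub>R b = a + v *\<^sub>R (b - a)"
      by (simp add: algebra_simps)
    ultimately have "f (a + v *\<^sub>R (b - a)) - f a \<le> (f b - f a - m / 2 * (1 - v) * q) * v"
      by (simp add: q_def norm_minus_commute algebra_simps)
    then show ?thesis
      using that by (simp add: pos_divide_le_eq)
  qed
  have "((\<lambda>v. f b - f a - m / 2 * (1 - v) * q) \<longlongrightarrow> f b - f a - m / 2 * (1 - 0) * q) (at_right 0)"
    by (intro tendsto_intros)
  then have "gradient f a \<bullet> (b - a) \<le> f b - f a - m / 2 * (1 - 0) * q"
  proof (rule tendsto_le[OF _ _ lim, rotated])
    show "\<forall>\<^sub>F v in at_right 0. (f (a + v *\<^sub>R (b - a)) - f a) / v \<le> f b - f a - m / 2 * (1 - v) * q"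
      using le unfolding eventually_at_right_field by (intro exI[of _ 1]) auto
  qed simp
  then show ?thesis
    by (simp add: q_def)
qed

text \<open>
  The descent lemma. Along the segment, the function minus its first-order model minus the
  quadratic term has a nonpositive derivative, by Cauchy-Schwarz and the Lipschitz bound.
\<close>

lemma lipschitz_gradient_upper_bound:
  fixes f :: "real ^ 'd \<Rightarrow> real"
  assumes diff: "\<And>y. f differentiable (at y)" and lip: "lipschitz_on L UNIV (gradient f)"
  shows "f b \<le> f a + gradient f a \<bullet> (b - a) + L / 2 * (norm (b - a))\<^sup>2"
proof -
  define d where "d = b - a"
  define \<phi> where "\<phi> s = f (a + s *\<^sub>R d) - s * (gradient f a \<bullet> d) - L / 2 * (norm d)\<^sup>2 * s\<^sup>2" for s
  have "\<phi> 1 \<le> \<phi> 0"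
  proof (rule DERIV_nonpos_imp_nonincreasing[of 0 1 \<phi>])
    fix s :: real
    assume s: "0 \<le> s" "s \<le> 1"
    let ?D = "gradient f (a + s *\<^sub>R d) \<bullet> d - gradient f a \<bullet> d - L * (norm d)\<^sup>2 * s"
    have "(\<phi> has_real_derivative ?D) (at s)"
      unfolding \<phi>_def
      by (auto intro!: derivative_eq_intros GDERIV_along_line diff)
    moreover have "?D \<le> 0"
    proof -
      have "(gradient f (a + s *\<^sub>R d) - gradient f a) \<bullet> d
          \<le> norm (gradient f (a + s *\<^sub>R d) - gradient f a) * norm d"
        by (rule norm_cauchy_schwarz)
      also have "\<dots> \<le> L * norm (s *\<^sub>R d) * norm d"
        using lipschitz_onD[OF lip, of "a + s *\<^sub>R d" a]
        by (intro mult_right_mono) (auto simp: dist_norm)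
      also have "\<dots> = L * (norm d)\<^sup>2 * s"
        using s by (simp add: power2_eq_square)
      finally show ?thesis
        by (simp add: inner_diff_left)
    qed
    ultimately show "\<exists>y. (\<phi> has_real_derivative y) (at s) \<and> y \<le> 0"
      by blast
  qed simp
  then show ?thesis
    by (simp add: \<phi>_def d_def)
qed

text \<open>
  With \<open>h z = f z - m/2 |z|\<^sup>2\<close>, the vector \<open>g\<close> is \<open>\<nabla>h(a) - \<nabla>h(b)\<close>, and this is the usual
  improvement of the convexity inequality for \<open>h\<close> obtained from one gradient step: bound \<open>f\<close> at
  \<open>a - s g\<close> from below by strong convexity at \<open>b\<close> and from above by the descent lemma at \<open>a\<close>.
  The step \<open>s\<close> is left free, because the optimal step \<open>1 / (L - m)\<close> does not exist when \<open>m = L\<close>.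
\<close>

lemma smooth_strongly_convex_step_bound:
  fixes f :: "real ^ 'd \<Rightarrow> real"
  assumes f: "f \<in> smooth_strongly_convex m L"
    and g: "g = gradient f a - gradient f b - m *\<^sub>R (a - b)"
  shows "f b + gradient f b \<bullet> (a - b) + m / 2 * (norm (a - b))\<^sup>2
      + (s - (L - m) / 2 * s\<^sup>2) * (norm g)\<^sup>2 \<le> f a"
proof -
  have diff: "\<And>y. f differentiable (at y)" and sc: "strongly_convex_on UNIV m f"
    and lip: "lipschitz_on L UNIV (gradient f)"
    using f by (auto simp: smooth_strongly_convex_def)
  have "f b + gradient f b \<bullet> (a - s *\<^sub>R g - b) + m / 2 * (norm (a - s *\<^sub>R g - b))\<^sup>2
      \<le> f (a - s *\<^sub>R g)"
    by (rule strongly_convex_gradient_lower_bound[OF sc diff])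
  also have "\<dots> \<le> f a + gradient f a \<bullet> (a - s *\<^sub>R g - a) + L / 2 * (norm (a - s *\<^sub>R g - a))\<^sup>2"
    by (rule lipschitz_gradient_upper_bound[OF diff lip])
  finally have main: "f b + gradient f b \<bullet> (a - s *\<^sub>R g - b) + m / 2 * (norm (a - s *\<^sub>R g - b))\<^sup>2
      \<le> f a - s * (gradient f a \<bullet> g) + L / 2 * (s\<^sup>2 * (norm g)\<^sup>2)"
    by (simp add: power_mult_distrib)
  have lhs: "gradient f b \<bullet> (a - s *\<^sub>R g - b) = gradient f b \<bullet> (a - b) - s * (gradient f b \<bullet> g)"
    by (simp add: inner_diff_right)
  have sq: "(norm (a - s *\<^sub>R g - b))\<^sup>2 = (norm (a - b))\<^sup>2 - 2 * s * ((a - b) \<bullet> g) + s\<^sup>2 * (norm g)\<^sup>2"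
    unfolding power2_norm_eq_inner
    by (simp add: inner_diff_left inner_diff_right power2_eq_square algebra_simps inner_commute)
  have "s * (gradient f a \<bullet> g)
      = s * (gradient f b \<bullet> g) + s * m * ((a - b) \<bullet> g) + s * (norm g)\<^sup>2"
  proof -
    have "(norm g)\<^sup>2 = (gradient f a - gradient f b - m *\<^sub>R (a - b)) \<bullet> g"
      by (simp add: power2_norm_eq_inner flip: g)
    then have "gradient f a \<bullet> g = gradient f b \<bullet> g + m * ((a - b) \<bullet> g) + (norm g)\<^sup>2"
      by (simp add: inner_diff_left)
    then show ?thesis
      by (simp add: distrib_left)
  qed
  then show ?thesis
    using main unfolding lhs sq by (simp add: algebra_simps diff_divide_distrib)
qed

text \<open>
  Adding the step bounds for \<open>(a, b)\<close> and \<open>(b, a)\<close> cancels all function values and leaves an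
  inequality between \<open>|g|\<^sup>2\<close> and \<open>g\<^sup>T (a - b)\<close>. Optimizing the step gives cocoercivity of the
  gradient of \<open>f - m/2 |\<cdot>|\<^sup>2\<close> with constant \<open>1 / (L - m)\<close>, or a constant gradient when
  \<open>m = L\<close>; rewritten in terms of the gradient of
  \<open>f\<close>, this is the claim.
\<close>

lemma smooth_strongly_convex_cocoercive:
  fixes f :: "real ^ 'd \<Rightarrow> real"
  assumes f: "f \<in> smooth_strongly_convex m L" and mL: "m \<le> L"
  shows "m * L * (norm (a - b))\<^sup>2 + (norm (gradient f a - gradient f b))\<^sup>2
      \<le> (m + L) * ((gradient f a - gradient f b) \<bullet> (a - b))"
proof -
  define h where "h = gradient f a - gradient f b"
  define g where "g = h - m *\<^sub>R (a - b)"
  have step: "(2 * s - (L - m) * s\<^sup>2) * (norm g)\<^sup>2 \<le> g \<bullet> (a - b)" for s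
  proof -
    have g': "norm (gradient f b - gradient f a - m *\<^sub>R (b - a)) = norm g"
      by (subst norm_minus_cancel[symmetric]) (simp add: g_def h_def algebra_simps)
    have "f b + gradient f b \<bullet> (a - b) + m / 2 * (norm (a - b))\<^sup>2
      + (s - (L - m) / 2 * s\<^sup>2) * (norm g)\<^sup>2 \<le> f a"
      by (rule smooth_strongly_convex_step_bound[OF f]) (simp add: g_def h_def)
    moreover have "f a + gradient f a \<bullet> (b - a) + m / 2 * (norm (a - b))\<^sup>2
      + (s - (L - m) / 2 * s\<^sup>2) * (norm g)\<^sup>2 \<le> f b"
      using smooth_strongly_convex_step_bound[OF f refl, where a = b and b = a and s = s]
      by (simp add: g' norm_minus_commute[of b a])
    moreover have "g \<bullet> (a - b) = - (gradient f b \<bullet> (a - b)) - gradient f a \<bullet> (b - a) - m * (norm (a - b))\<^sup>2"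
      unfolding g_def h_def power2_norm_eq_inner
      by (simp add: inner_diff_left inner_diff_right algebra_simps)
    ultimately show ?thesis
      by (simp add: algebra_simps diff_divide_distrib)
  qed
  have bound: "(norm g)\<^sup>2 \<le> (L - m) * (g \<bullet> (a - b))"
  proof (cases "m = L")
    case True
    \<comment> \<open>Now \<open>step\<close> bounds a multiple of \<open>s\<close> uniformly in \<open>s\<close>; a large step refutes \<open>g \<noteq> 0\<close>.\<close>
    have "norm g = 0"
    proof (rule ccontr)
      assume "norm g \<noteq> 0"
      then show False
        using step[of "(g \<bullet> (a - b) + 1) / (2 * (norm g)\<^sup>2)"] True by simp
    qed
    then show ?thesis
      using True by simp
  next
    case False
    then have "0 < L - m"
      using mL by simp
    then have "2 * (1 / (L - m)) - (L - m) * (1 / (L - m))\<^sup>2 = 1 / (L - m)"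
      by (simp add: power2_eq_square)
    then have "(1 / (L - m)) * (norm g)\<^sup>2 \<le> g \<bullet> (a - b)"
      using step[of "1 / (L - m)"] by simp
    then show ?thesis
      using \<open>0 < L - m\<close> by (simp add: pos_divide_le_eq mult.commute)
  qed
  have "(norm g)\<^sup>2 = (norm h)\<^sup>2 - 2 * m * (h \<bullet> (a - b)) + m\<^sup>2 * (norm (a - b))\<^sup>2"
    unfolding g_def power2_norm_eq_inner
    by (simp add: inner_diff_left inner_diff_right power2_eq_square algebra_simps inner_commute)
  moreover have "g \<bullet> (a - b) = h \<bullet> (a - b) - m * (norm (a - b))\<^sup>2"
    unfolding g_def power2_norm_eq_inner by (simp add: inner_diff_left)
  ultimately have "(norm h)\<^sup>2 - 2 * m * (h \<bullet> (a - b)) + m\<^sup>2 * (norm (a - b))\<^sup>2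
      \<le> (L - m) * (h \<bullet> (a - b) - m * (norm (a - b))\<^sup>2)"
    using bound by simp
  then show ?thesis
    unfolding h_def[symmetric]
    by (simp add: left_diff_distrib right_diff_distrib distrib_right power2_eq_square)
      (simp add: mult_ac)
qed

lemma gradient_at_minimizer:
  fixes f :: "real ^ 'd \<Rightarrow> real"
  assumes "f differentiable (at a)" and "\<And>y. f a \<le> f y"
  shows "gradient f a = 0"
proof -
  have "(f has_derivative (\<lambda>h. h \<bullet> gradient f a)) (at a)"
    using GDERIV_gradient[OF assms(1)] by (simp add: gderiv_def)
  then have "(\<lambda>h. h \<bullet> gradient f a) = (\<lambda>h. 0)"
    by (rule has_derivative_local_min) (simp add: assms(2))
  then show ?thesis
    by (metis inner_eq_zero_iff)
qed

section \<open>Quadratic forms of block matrices\<close>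

definition stack :: "real ^ 'a \<Rightarrow> real ^ 'b \<Rightarrow> real ^ ('a + 'b)"
  where "stack v w = (\<chi> i. case i of Inl a \<Rightarrow> v $ a | Inr b \<Rightarrow> w $ b)"

lemma sum_UNIV_Plus:
  fixes g :: "'a::finite + 'b::finite \<Rightarrow> real"
  shows "(\<Sum>i\<in>UNIV. g i) = (\<Sum>a\<in>UNIV. g (Inl a)) + (\<Sum>b\<in>UNIV. g (Inr b))"
  unfolding UNIV_Plus_UNIV[symmetric] by (subst sum.Plus) (auto simp: o_def)

lemma inner_stack: "stack v w \<bullet> stack v' w' = v \<bullet> v' + w \<bullet> w'"
  by (simp add: inner_vec_def stack_def sum_UNIV_Plus)

lemma block_mat_mult_stack:
  "block_mat P Q R S *v stack v w = stack (P *v v + Q *v w) (R *v v + S *v w)"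
  by (simp add: vec_eq_iff matrix_vector_mult_def block_mat_def stack_def sum_UNIV_Plus
      split: sum.split)

lemma quad_form_add: "quad_form (X + Y) w = quad_form X w + quad_form Y w"
  by (simp add: quad_form_def matrix_vector_mult_add_rdistrib inner_add_right)

lemma scaleR_matrix_vector_mult: "(c *\<^sub>R X) *v w = c *\<^sub>R (X *v (w :: real ^ 'n))"
  by (simp add: vec_eq_iff matrix_vector_mult_def sum_distrib_left mult.assoc)

lemma quad_form_scaleR_matrix: "quad_form (c *\<^sub>R X) w = c * quad_form X w"
  by (simp add: quad_form_def scaleR_matrix_vector_mult)

lemma quad_form_M0:
  assumes "symmetric_matrix P"
  shows "quad_form (M0 lam A B P) (stack e v)
      = 2 * (e \<bullet> (P *v (A *v e + B *v v))) + lam * (e \<bullet> (P *v e))"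
  using assms symmetric_matrix_inner_commute[OF assms, of "A *v e" e]
    symmetric_matrix_inner_commute[OF assms, of "B *v v" e]
    inner_matrix_vector_transpose[of e "transpose A" "P *v e"]
    inner_matrix_vector_transpose[of v "transpose B" "P *v e"]
  by (simp add: quad_form_def M0_def block_mat_mult_stack inner_stack inner_add_right
      matrix_vector_mult_add_rdistrib scaleR_matrix_vector_mult matrix_vector_right_distrib
      flip: matrix_vector_mul_assoc)

lemma quad_form_M1:
  "quad_form (M1 A B C) (stack e v) = v \<bullet> (C *v (A *v e + B *v v))"
proof -
  have "e \<bullet> (transpose (C ** A) *v v) = v \<bullet> (C *v (A *v e))"
    using inner_matrix_vector_transpose[of e "transpose (C ** A)" v]
    by (simp add: inner_commute flip: matrix_vector_mul_assoc)
  moreover have "v \<bullet> (transpose B *v (transpose C *v v)) = v \<bullet> (C *v (B *v v))"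
    using inner_matrix_vector_transpose[of v "transpose B" "transpose C *v v"]
      inner_matrix_vector_transpose[of "B *v v" "transpose C" v]
    by (simp add: inner_commute)
  ultimately show ?thesis
    by (simp add: quad_form_def M1_def block_mat_mult_stack inner_stack inner_add_right
      matrix_vector_mult_add_rdistrib scaleR_matrix_vector_mult matrix_vector_right_distrib
      flip: matrix_vector_mul_assoc)
qed

text \<open>
  The outer factors substitute \<open>C e\<close> for the first argument of the inner form, which is a
  combination of \<open>|y|\<^sup>2\<close>, \<open>v\<^sup>T y\<close> and \<open>|v|\<^sup>2\<close>; \<open>M2\<close> and \<open>M3\<close> are the instances that occur.
\<close>

lemma quad_form_output_weight:
  fixes C :: "real ^ 'n ^ 'd"
  shows "quad_form (block_mat (transpose C) 0 0 (mat 1)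
      ** block_mat (a *\<^sub>R mat 1) (b *\<^sub>R mat 1) (b *\<^sub>R mat 1) (c *\<^sub>R mat 1)
      ** block_mat C 0 0 (mat 1)) (stack e v)
    = a * (norm (C *v e))\<^sup>2 + 2 * b * (v \<bullet> (C *v e)) + c * (norm v)\<^sup>2"
proof -
  have "e \<bullet> (transpose C *v y) = (C *v e) \<bullet> y" for y
    using inner_matrix_vector_transpose[of e "transpose C" y] by simp
  then show ?thesis
    by (simp add: quad_form_def block_mat_mult_stack inner_stack inner_add_right
      scaleR_matrix_vector_mult matrix_vector_right_distrib power2_norm_eq_inner inner_commute
      matrix_vector_mult_scaleR flip: matrix_vector_mul_assoc)
qed

lemma quad_form_M2:
  "quad_form (M2 m C) (stack e v) = v \<bullet> (C *v e) - m / 2 * (norm (C *v e))\<^sup>2"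
  using quad_form_output_weight[of C "- (m / 2)" "1 / 2" 0 e v] by (simp add: M2_def)

lemma quad_form_M3:
  "quad_form (M3 m L C) (stack e v)
    = v \<bullet> (C *v e) - m * L / (m + L) * (norm (C *v e))\<^sup>2 - 1 / (m + L) * (norm v)\<^sup>2"
  using quad_form_output_weight[of C "- (m * L / (m + L))" "1 / 2" "- (1 / (m + L))" e v]
  by (simp add: M3_def)

section \<open>Decay of the Lyapunov function\<close>

lemma lyapunov_has_derivative:
  fixes \<xi> :: "real \<Rightarrow> real ^ 'n" and f :: "real ^ 'd \<Rightarrow> real"
  assumes \<xi>: "(\<xi> has_vector_derivative w) (at s within S)"
    and f: "f differentiable (at (C *v \<xi> s))" and P: "symmetric_matrix P"
  shows "((\<lambda>s. lyapunov lam f C P xstar \<xi>star (\<xi> s) s) has_real_derivative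
      exp (lam * s) * (lam * (f (C *v \<xi> s) - f xstar + (\<xi> s - \<xi>star) \<bullet> (P *v (\<xi> s - \<xi>star)))
        + gradient f (C *v \<xi> s) \<bullet> (C *v w) + 2 * ((\<xi> s - \<xi>star) \<bullet> (P *v w)))) (at s within S)"
proof -
  have d\<xi>: "(\<xi> has_derivative (\<lambda>h. h *\<^sub>R w)) (at s within S)"
    using \<xi> by (simp add: has_vector_derivative_def)
  have "((\<lambda>s. C *v \<xi> s) has_derivative (\<lambda>h. C *v (h *\<^sub>R w))) (at s within S)"
    by (rule bounded_linear.has_derivative[OF matrix_vector_mul_bounded_linear d\<xi>])
  then have "((\<lambda>s. f (C *v \<xi> s)) has_derivative (\<lambda>h. (C *v (h *\<^sub>R w)) \<bullet> gradient f (C *v \<xi> s)))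
      (at s within S)"
    by (rule has_derivative_compose) (use GDERIV_gradient[OF f] in \<open>simp add: gderiv_def\<close>)
  then have df: "((\<lambda>s. f (C *v \<xi> s)) has_real_derivative gradient f (C *v \<xi> s) \<bullet> (C *v w))
      (at s within S)"
    by (rule has_derivative_imp_has_field_derivative)
      (simp add: matrix_vector_mult_scaleR inner_commute)
  have de: "((\<lambda>s. \<xi> s - \<xi>star) has_derivative (\<lambda>h. h *\<^sub>R w)) (at s within S)"
    using d\<xi> by (auto intro!: derivative_eq_intros)
  have "((\<lambda>s. P *v (\<xi> s - \<xi>star)) has_derivative (\<lambda>h. P *v (h *\<^sub>R w))) (at s within S)"
    by (rule bounded_linear.has_derivative[OF matrix_vector_mul_bounded_linear de])
  with de have "((\<lambda>s. (\<xi> s - \<xi>star) \<bullet> (P *v (\<xi> s - \<xi>star))) has_derivative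
      (\<lambda>h. (\<xi> s - \<xi>star) \<bullet> (P *v (h *\<^sub>R w)) + (h *\<^sub>R w) \<bullet> (P *v (\<xi> s - \<xi>star))))
      (at s within S)"
    by (rule has_derivative_inner)
  then have dq: "((\<lambda>s. (\<xi> s - \<xi>star) \<bullet> (P *v (\<xi> s - \<xi>star))) has_real_derivative
      2 * ((\<xi> s - \<xi>star) \<bullet> (P *v w))) (at s within S)"
    by (rule has_derivative_imp_has_field_derivative)
      (simp add: matrix_vector_mult_scaleR symmetric_matrix_inner_commute[OF P, of w])
  show ?thesis
    unfolding lyapunov_def
    by (rule derivative_eq_intros df dq refl | simp add: algebra_simps)+
qed

text \<open>
  The left-hand side is \<open>exp (- lam * t)\<close> times the derivative of the Lyapunov function. Replacing
  the function gap by its upper bound \<open>z\<^sup>T M2 z\<close> and adding the nonnegative \<open>sig * z\<^sup>T M3 z\<close> (an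
  S-procedure) turns it into the form of \<open>T_bar\<close>.
\<close>

lemma LMI_dissipation:
  fixes f :: "real ^ 'd \<Rightarrow> real" and e :: "real ^ 'n"
  assumes m: "0 < m" "m \<le> L" and f: "f \<in> smooth_strongly_convex m L"
    and min: "\<And>y. f xstar \<le> f y"
    and lam: "0 \<le> lam" and sig: "0 \<le> sig" and P: "symmetric_matrix P"
    and T: "neg_semidefinite (T_bar m L lam sig A B C P)"
    and y: "y = xstar + C *v e" and v: "v = gradient f y" and w: "w = A *v e + B *v v"
  shows "lam * (f y - f xstar + e \<bullet> (P *v e)) + v \<bullet> (C *v w) + 2 * (e \<bullet> (P *v w)) \<le> 0"
proof -
  have diff: "\<And>z. f differentiable (at z)" and sc: "strongly_convex_on UNIV m f"
    using f by (auto simp: smooth_strongly_convex_def)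
  have "f y + v \<bullet> (xstar - y) + m / 2 * (norm (xstar - y))\<^sup>2 \<le> f xstar"
    unfolding v by (rule strongly_convex_gradient_lower_bound[OF sc diff])
  then have M2: "f y - f xstar \<le> quad_form (M2 m C) (stack e v)"
    by (simp add: quad_form_M2 y)
  have "m * L * (norm (C *v e))\<^sup>2 + (norm v)\<^sup>2 \<le> (m + L) * (v \<bullet> (C *v e))"
    using smooth_strongly_convex_cocoercive[OF f m(2), of y xstar]
      gradient_at_minimizer[OF diff min]
    by (simp add: y v)
  then have "(m * L * (norm (C *v e))\<^sup>2 + (norm v)\<^sup>2) / (m + L) \<le> v \<bullet> (C *v e)"
    using m by (simp add: pos_divide_le_eq mult.commute)
  then have M3: "0 \<le> quad_form (M3 m L C) (stack e v)"
    by (simp add: quad_form_M3 add_divide_distrib)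
  have "lam * (f y - f xstar + e \<bullet> (P *v e)) + v \<bullet> (C *v w) + 2 * (e \<bullet> (P *v w))
      = quad_form (M0 lam A B P) (stack e v) + quad_form (M1 A B C) (stack e v)
        + lam * (f y - f xstar)"
    unfolding quad_form_M0[OF P] quad_form_M1 w by (simp add: algebra_simps)
  also have "\<dots> \<le> quad_form (T_bar m L lam sig A B C P) (stack e v)"
    using mult_left_mono[OF M2 lam] mult_nonneg_nonneg[OF sig M3]
    by (simp add: T_bar_def quad_form_add quad_form_scaleR_matrix)
  also have "\<dots> \<le> 0"
    using T by (simp add: neg_semidefinite_def)
  finally show ?thesis .
qed

lemma lyapunov_nonincreasing:
  fixes f :: "real ^ 'd \<Rightarrow> real" and \<xi> :: "real \<Rightarrow> real ^ 'n"
  assumes m: "0 < m" "m \<le> L" and f: "f \<in> smooth_strongly_convex m L"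
    and min: "\<And>y. f xstar \<le> f y"
    and A: "A *v \<xi>star = 0" and C: "C *v \<xi>star = xstar"
    and lam: "0 \<le> lam" and sig: "0 \<le> sig" and P: "symmetric_matrix P"
    and T: "neg_semidefinite (T_bar m L lam sig A B C P)"
    and sol: "is_solution A B C f \<xi> x u" and t: "0 \<le> t"
  shows "lyapunov lam f C P xstar \<xi>star (\<xi> t) t \<le> lyapunov lam f C P xstar \<xi>star (\<xi> 0) 0"
proof (rule DERIV_nonpos_imp_decreasing_open[OF t])
  let ?V = "\<lambda>s. lyapunov lam f C P xstar \<xi>star (\<xi> s) s"
  have diff: "\<And>z. f differentiable (at z)"
    using f by (auto simp: smooth_strongly_convex_def)
  have decr: "\<exists>D. (?V has_real_derivative D) (at s within {0..}) \<and> D \<le> 0" if "0 \<le> s" for s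
  proof -
    let ?w = "A *v \<xi> s + B *v u s"
    have \<xi>: "(\<xi> has_vector_derivative ?w) (at s within {0..})"
      and u: "u s = gradient f (C *v \<xi> s)"
      using sol that by (auto simp: is_solution_def)
    have y: "C *v \<xi> s = xstar + C *v (\<xi> s - \<xi>star)"
      by (simp add: matrix_vector_mult_diff_distrib C)
    have w: "?w = A *v (\<xi> s - \<xi>star) + B *v u s"
      by (simp add: matrix_vector_mult_diff_distrib A)
    show ?thesis
      using lyapunov_has_derivative[OF \<xi> diff P]
        mult_nonneg_nonpos[OF _ LMI_dissipation[OF m f min lam sig P T y u w]]
      unfolding u by (intro exI conjI) auto
  qed
  \<comment> \<open>The derivative at \<open>0\<close> is one-sided, so the end points enter only through continuity.\<close>
  show "\<exists>D. (?V has_real_derivative D) (at s) \<and> D \<le> 0" if "0 < s" "s < t" for s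
    using decr[of s] that at_within_interior[of s "{0..}"] by (simp add: interior_Ici[of "-1"])
  show "continuous_on {0..t} ?V"
    unfolding continuous_on_eq_continuous_within
  proof
    fix s assume "s \<in> {0..t}"
    then obtain D where "(?V has_real_derivative D) (at s within {0..})"
      using decr[of s] by auto
    then have "continuous (at s within {0..}) ?V"
      by (rule DERIV_continuous)
    then show "continuous (at s within {0..t}) ?V"
      by (rule continuous_within_subset) auto
  qed
qed

text \<open>
  The gradient vanishes at the minimizer, so strong convexity there bounds the function gap below
  by \<open>m/2 |C (w - \<xi>star)|\<^sup>2\<close>: the difference between the forms of \<open>P_tilde\<close> and \<open>P\<close>.
\<close>

lemma quad_form_P_tilde_le_lyapunov:
  fixes f :: "real ^ 'd \<Rightarrow> real"
  assumes f: "f \<in> smooth_strongly_convex m L" and min: "\<And>y. f xstar \<le> f y"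
    and C: "C *v \<xi>star = xstar"
  shows "quad_form (P_tilde m C P) (w - \<xi>star)
      \<le> exp (- lam * t) * lyapunov lam f C P xstar \<xi>star w t"
proof -
  have diff: "\<And>z. f differentiable (at z)" and sc: "strongly_convex_on UNIV m f"
    using f by (auto simp: smooth_strongly_convex_def)
  have "m / 2 * (norm (C *v (w - \<xi>star)))\<^sup>2 \<le> f (C *v w) - f xstar"
    using strongly_convex_gradient_lower_bound[OF sc diff, of xstar "C *v w"]
      gradient_at_minimizer[OF diff min]
    by (simp add: matrix_vector_mult_diff_distrib C)
  moreover have "quad_form (P_tilde m C P) (w - \<xi>star)
      = (w - \<xi>star) \<bullet> (P *v (w - \<xi>star)) + m / 2 * (norm (C *v (w - \<xi>star)))\<^sup>2"
    by (simp only: P_tilde_def quad_form_add quad_form_scaleR_matrix quad_form_gram)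
      (simp add: quad_form_def)
  moreover have "exp (- lam * t) * lyapunov lam f C P xstar \<xi>star w t
      = f (C *v w) - f xstar + (w - \<xi>star) \<bullet> (P *v (w - \<xi>star))"
    by (simp add: lyapunov_def exp_minus)
  ultimately show ?thesis
    by simp
qed

theorem theorem2p1:
  fixes f :: "real ^ 'd \<Rightarrow> real"
    and m L lam sig :: real
    and A :: "real ^ 'n ^ 'n" and B :: "real ^ 'd ^ 'n" and C :: "real ^ 'n ^ 'd"
    and P :: "real ^ 'n ^ 'n"
    and xstar :: "real ^ 'd" and \<xi>star :: "real ^ 'n"
    and \<xi> :: "real \<Rightarrow> real ^ 'n" and x u :: "real \<Rightarrow> real ^ 'd"
    and t :: real
  assumes "CARD('d) \<le> CARD('n)"
    and "0 < m" and "m \<le> L"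
    and "f \<in> smooth_strongly_convex m L"
    and "\<forall>y. f xstar \<le> f y"
    and "A *v \<xi>star = 0" and "C *v \<xi>star = xstar"
    and "0 < lam" and "0 \<le> sig"
    and "symmetric_matrix P"
    and "pos_definite (P_tilde m C P)"
    and "neg_semidefinite (T_bar m L lam sig A B C P)"
    and "is_solution A B C f \<xi> x u"
    and "0 \<le> t"
  shows "(norm (x t - xstar))\<^sup>2
           \<le> lambda_max (transpose C ** C) * (norm (\<xi> t - \<xi>star))\<^sup>2
         \<and> lambda_max (transpose C ** C) * (norm (\<xi> t - \<xi>star))\<^sup>2
           \<le> lambda_max (transpose C ** C) / lambda_min (P_tilde m C P)
               * quad_form (P_tilde m C P) (\<xi> t - \<xi>star)
         \<and> lambda_max (transpose C ** C) / lambda_min (P_tilde m C P)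
               * quad_form (P_tilde m C P) (\<xi> t - \<xi>star)
           \<le> lambda_max (transpose C ** C) / lambda_min (P_tilde m C P)
               * exp (- lam * t) * lyapunov lam f C P xstar \<xi>star (\<xi> 0) 0"
proof -
  let ?G = "transpose C ** C" and ?P = "P_tilde m C P" and ?e = "\<xi> t - \<xi>star"
  have min: "\<And>y. f xstar \<le> f y" using assms(5) by blast
  have "x t - xstar = C *v ?e"
    using assms(7,13,14) by (auto simp: is_solution_def matrix_vector_mult_diff_distrib)
  then have output_bound: "(norm (x t - xstar))\<^sup>2 \<le> lambda_max ?G * (norm ?e)\<^sup>2"
    using quad_form_le_lambda_max[OF symmetric_matrix_gram, of C ?e]
    by (simp add: quad_form_gram)
  have pos: "0 < lambda_min ?P"
    using assms(11) by (rule lambda_min_pos)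
  have ratio: "0 \<le> lambda_max ?G / lambda_min ?P"
    using lambda_max_gram_nonneg[of C] pos by simp
  have "lambda_min ?P * (norm ?e)\<^sup>2 \<le> quad_form ?P ?e"
    using assms(11) by (intro lambda_min_le_quad_form) (simp add: pos_definite_def)
  from mult_left_mono[OF this ratio]
  have state_bound: "lambda_max ?G * (norm ?e)\<^sup>2 \<le> lambda_max ?G / lambda_min ?P * quad_form ?P ?e"
    using pos by simp
  have "quad_form ?P ?e \<le> exp (- lam * t) * lyapunov lam f C P xstar \<xi>star (\<xi> t) t"
    by (rule quad_form_P_tilde_le_lyapunov[OF assms(4) min assms(7)])
  also have "\<dots> \<le> exp (- lam * t) * lyapunov lam f C P xstar \<xi>star (\<xi> 0) 0"
    using assms by (intro mult_left_mono lyapunov_nonincreasing[OF assms(2-4) min]) auto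
  finally have "lambda_max ?G / lambda_min ?P * quad_form ?P ?e
      \<le> lambda_max ?G / lambda_min ?P * exp (- lam * t) * lyapunov lam f C P xstar \<xi>star (\<xi> 0) 0"
    using ratio by (simp only: mult.assoc mult_left_mono)
  then show ?thesis
    using output_bound state_bound by blast
qed

end
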